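(* Let $m\ge1$, let $\mu_2,\dots,\mu_{m+1}\ge0$ be integers with $\mu_{m+1}\neq0$, and let $\mathbf S=\mathbf 2^{\mu_2}\times\mathbf 3_L^{\mu_3}\times\dots\times(\mathbf{m+1})_L^{\mu_{m+1}}$. Then $\mathbf S$ is a homomorphic image of the free left-handed skew Boolean algebra ${}_{\mathcal L}\mathbf{SBA}_n$ on $n$ generators if and only if (i) $n\ge m$; (ii) $\Gamma_m^n\ge\mu_{m+1}$, $\Gamma_{m-1}^n\ge\mu_{m+1}+\mu_m$, and in general $\Gamma_k^n\ge\mu_{m+1}+\mu_m+\dots+\mu_{k+1}$ for all indices $k$ with $1\le k\le m$. Such an ${}_{\mathcal L}\mathbf{SBA}_n$ exists, with the least such $n$ for which this occurs being the rank $\rho(\mathbf S)$. (A similar assertion holds in the right-handed case, with $\mathbf k_R$ in place of $\mathbf k_L$ and the free right-handed skew Boolean algebra in place of ${}_{\mathcal L}\mathbf{SBA}_n$.)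
   Context: A skew lattice is an algebra $(S;\wedge,\vee)$ with associative binary operations satisfying $x\wedge(x\vee y)=x=(y\vee x)\wedge x$ and $x\vee(x\wedge y)=x=(y\wedge x)\vee x$. A skew Boolean algebra is an algebra $(S;\wedge,\vee,\setminus,0)$ such that $(S;\wedge,\vee)$ is a skew lattice satisfying $x\wedge(y\vee z)=(x\wedge y)\vee(x\wedge z)$ and $(x\vee y)\wedge z=(x\wedge z)\vee(y\wedge z)$, $0$ satisfies $0\wedge x=0=x\wedge 0$ and $0\vee x=x=x\vee 0$, and $(x\wedge y\wedge x)\vee(x\setminus y)=x$, $(x\wedge y\wedge x)\wedge(x\setminus y)=0=(x\setminus y)\wedge(x\wedge y\wedge x)$. It is left-handed if $x\wedge y\wedge x=x\wedge y$ and $x\vee y\vee x=y\vee x$ hold, right-handed if $x\wedge y\wedge x=y\wedge x$ and $x\vee y\vee x=x\vee y$ hold. Each of these classes is a variety, and free algebras are taken in the respective variety. $\mathbf n_L$ is the left-handed skew Boolean algebra on $\{0,1,\dots,n-1\}$ with zero element $0$ and, for nonzero $x,y$: $x\wedge y=x$, $x\vee y=y$, $x\setminus y=0$ (and $x\setminus 0=x$, $0\setminus x=0$). $\mathbf n_R$ is its right-handed dual ($x\wedge y=y$, $x\vee y=x$ for nonzero $x,y$). $\mathbf 2=\mathbf 2_L=\mathbf 2_R$. For $n\ge m$, $\Gamma_m^n=\binom nm+\binom n{m+1}+\dots+\binom nn$. The rank $\rho(\mathbf S)$ of a skew Boolean algebra $\mathbf S$ is the least integer $n$ such that $\mathbf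 S$ can be generated by $n$ elements. *)

theory Defs
  imports Main "HOL-Library.FuncSet"
begin

record 'a skew_alg =
  carrier :: "'a set"
  meet :: "'a \<Rightarrow> 'a \<Rightarrow> 'a" (infixl "\<sqinter>\<index>" 70)
  join :: "'a \<Rightarrow> 'a \<Rightarrow> 'a" (infixl "\<squnion>\<index>" 65)
  diff :: "'a \<Rightarrow> 'a \<Rightarrow> 'a" (infixl "\<ominus>\<index>" 65)
  zero :: "'a" ("\<zero>\<index>")

locale skew_lattice =
  fixes S (structure)
  assumes meet_closed: "\<lbrakk>x \<in> carrier S; y \<in> carrier S\<rbrakk> \<Longrightarrow> x \<sqinter> y \<in> carrier S"
    and join_closed: "\<lbrakk>x \<in> carrier S; y \<in> carrier S\<rbrakk> \<Longrightarrow> x \<squnion> y \<in> carrier S"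
    and meet_assoc: "\<lbrakk>x \<in> carrier S; y \<in> carrier S; z \<in> carrier S\<rbrakk>
          \<Longrightarrow> (x \<sqinter> y) \<sqinter> z = x \<sqinter> (y \<sqinter> z)"
    and join_assoc: "\<lbrakk>x \<in> carrier S; y \<in> carrier S; z \<in> carrier S\<rbrakk>
          \<Longrightarrow> (x \<squnion> y) \<squnion> z = x \<squnion> (y \<squnion> z)"
    and absorb1: "\<lbrakk>x \<in> carrier S; y \<in> carrier S\<rbrakk> \<Longrightarrow> x \<sqinter> (x \<squnion> y) = x"
    and absorb2: "\<lbrakk>x \<in> carrier S; y \<in> carrier S\<rbrakk> \<Longrightarrow> (y \<squnion> x) \<sqinter> x = x"
    and absorb3: "\<lbrakk>x \<in> carrier S; y \<in> carrier S\<rbrakk> \<Longrightarrow> x \<squnion> (x \<sqinter> y) = x"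
    and absorb4: "\<lbrakk>x \<in> carrier S; y \<in> carrier S\<rbrakk> \<Longrightarrow> (y \<sqinter> x) \<squnion> x = x"

locale skew_boolean_algebra = skew_lattice +
  assumes diff_closed: "\<lbrakk>x \<in> carrier S; y \<in> carrier S\<rbrakk> \<Longrightarrow> x \<ominus> y \<in> carrier S"
    and zero_closed: "\<zero> \<in> carrier S"
    and distrib_left: "\<lbrakk>x \<in> carrier S; y \<in> carrier S; z \<in> carrier S\<rbrakk>
          \<Longrightarrow> x \<sqinter> (y \<squnion> z) = (x \<sqinter> y) \<squnion> (x \<sqinter> z)"
    and distrib_right: "\<lbrakk>x \<in> carrier S; y \<in> carrier S; z \<in> carrier S\<rbrakk>
          \<Longrightarrow> (x \<squnion> y) \<sqinter> z = (x \<sqinter> z) \<squnion> (y \<sqinter> z)"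
    and zero_meet: "x \<in> carrier S \<Longrightarrow> \<zero> \<sqinter> x = \<zero>"
    and meet_zero: "x \<in> carrier S \<Longrightarrow> x \<sqinter> \<zero> = \<zero>"
    and zero_join: "x \<in> carrier S \<Longrightarrow> \<zero> \<squnion> x = x"
    and join_zero: "x \<in> carrier S \<Longrightarrow> x \<squnion> \<zero> = x"
    and diff_join: "\<lbrakk>x \<in> carrier S; y \<in> carrier S\<rbrakk> \<Longrightarrow> (x \<sqinter> y \<sqinter> x) \<squnion> (x \<ominus> y) = x"
    and diff_meet1: "\<lbrakk>x \<in> carrier S; y \<in> carrier S\<rbrakk> \<Longrightarrow> (x \<sqinter> y \<sqinter> x) \<sqinter> (x \<ominus> y) = \<zero>"
    and diff_meet2: "\<lbrakk>x \<in> carrier S; y \<in> carrier S\<rbrakk> \<Longrightarrow> (x \<ominus> y) \<sqinter> (x \<sqinter> y \<sqinter> x) = \<zero>"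

datatype handedness = LeftHanded | RightHanded

locale handed_skew_boolean_algebra = skew_boolean_algebra +
  fixes h :: handedness
  assumes left_meet: "\<lbrakk>h = LeftHanded; x \<in> carrier S; y \<in> carrier S\<rbrakk> \<Longrightarrow> x \<sqinter> y \<sqinter> x = x \<sqinter> y"
    and left_join: "\<lbrakk>h = LeftHanded; x \<in> carrier S; y \<in> carrier S\<rbrakk> \<Longrightarrow> x \<squnion> y \<squnion> x = y \<squnion> x"
    and right_meet: "\<lbrakk>h = RightHanded; x \<in> carrier S; y \<in> carrier S\<rbrakk> \<Longrightarrow> x \<sqinter> y \<sqinter> x = y \<sqinter> x"
    and right_join: "\<lbrakk>h = RightHanded; x \<in> carrier S; y \<in> carrier S\<rbrakk> \<Longrightarrow> x \<squnion> y \<squnion> x = x \<squnion> y"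

definition hom :: "('a, 'm) skew_alg_scheme \<Rightarrow> ('b, 'n) skew_alg_scheme \<Rightarrow> ('a \<Rightarrow> 'b) set" where
  "hom A B = {f \<in> carrier A \<rightarrow> carrier B.
     (\<forall>x \<in> carrier A. \<forall>y \<in> carrier A.
        f (x \<sqinter>\<^bsub>A\<^esub> y) = f x \<sqinter>\<^bsub>B\<^esub> f y \<and>
        f (x \<squnion>\<^bsub>A\<^esub> y) = f x \<squnion>\<^bsub>B\<^esub> f y \<and>
        f (x \<ominus>\<^bsub>A\<^esub> y) = f x \<ominus>\<^bsub>B\<^esub> f y) \<and>
     f \<zero>\<^bsub>A\<^esub> = \<zero>\<^bsub>B\<^esub>}"

definition is_hom_image_of ::
    "('b, 'n) skew_alg_scheme \<Rightarrow> ('a, 'm) skew_alg_scheme \<Rightarrow> bool" where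
  "is_hom_image_of B A \<longleftrightarrow> (\<exists>f \<in> hom A B. f ` carrier A = carrier B)"

inductive_set generated :: "('a, 'm) skew_alg_scheme \<Rightarrow> 'a set \<Rightarrow> 'a set"
  for S (structure) and G where
  gen_base: "x \<in> G \<Longrightarrow> x \<in> generated S G"
| gen_zero: "\<zero> \<in> generated S G"
| gen_meet: "\<lbrakk>x \<in> generated S G; y \<in> generated S G\<rbrakk> \<Longrightarrow> x \<sqinter> y \<in> generated S G"
| gen_join: "\<lbrakk>x \<in> generated S G; y \<in> generated S G\<rbrakk> \<Longrightarrow> x \<squnion> y \<in> generated S G"
| gen_diff: "\<lbrakk>x \<in> generated S G; y \<in> generated S G\<rbrakk> \<Longrightarrow> x \<ominus> y \<in> generated S G"

definition rank :: "('a, 'm) skew_alg_scheme \<Rightarrow> nat" where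
  "rank S = (LEAST n. \<exists>G \<subseteq> carrier S. finite G \<and> card G = n \<and> generated S G = carrier S)"

text \<open>The algebra on \<open>{0,1,\<dots>,k-1}\<close>; for \<open>k = 2\<close> it does not depend on the handedness.\<close>

definition primitive_alg :: "handedness \<Rightarrow> nat \<Rightarrow> nat skew_alg" where
  "primitive_alg h k = \<lparr>
     carrier = {0..<k},
     meet = (\<lambda>x y. if x = 0 \<or> y = 0 then 0
                   else case h of LeftHanded \<Rightarrow> x | RightHanded \<Rightarrow> y),
     join = (\<lambda>x y. if x = 0 then y else if y = 0 then x
                   else case h of LeftHanded \<Rightarrow> y | RightHanded \<Rightarrow> x),
     diff = (\<lambda>x y. if y = 0 then x else 0),
     zero = 0\<rparr>"

definition product_alg :: "'i set \<Rightarrow> ('i \<Rightarrow> 'a skew_alg) \<Rightarrow> ('i \<Rightarrow> 'a) skew_alg" where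
  "product_alg I A = \<lparr>
     carrier = (\<Pi>\<^sub>E i\<in>I. carrier (A i)),
     meet = (\<lambda>x y. \<lambda>i\<in>I. x i \<sqinter>\<^bsub>A i\<^esub> y i),
     join = (\<lambda>x y. \<lambda>i\<in>I. x i \<squnion>\<^bsub>A i\<^esub> y i),
     diff = (\<lambda>x y. \<lambda>i\<in>I. x i \<ominus>\<^bsub>A i\<^esub> y i),
     zero = (\<lambda>i\<in>I. \<zero>\<^bsub>A i\<^esub>)\<rparr>"

definition power_alg :: "'a skew_alg \<Rightarrow> nat \<Rightarrow> (nat \<Rightarrow> 'a) skew_alg" where
  "power_alg A r = product_alg {..<r} (\<lambda>_. A)"

text \<open>The free algebra on \<open>X\<close> is the algebra of terms over \<open>X\<close> modulo provable equality from
  the identities of the variety. Its membership in the variety and its universal property, with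
  targets of arbitrary type, are proved below.\<close>

datatype 'x sba_term =
    Var 'x
  | Zero
  | Meet "'x sba_term" "'x sba_term" (infixl "\<^bold>\<and>" 70)
  | Join "'x sba_term" "'x sba_term" (infixl "\<^bold>\<or>" 65)
  | Diff "'x sba_term" "'x sba_term" (infixl "\<^bold>-" 65)

inductive provable :: "handedness \<Rightarrow> 'x sba_term \<Rightarrow> 'x sba_term \<Rightarrow> bool" for h where
  refl: "provable h s s"
| sym: "provable h s t \<Longrightarrow> provable h t s"
| trans: "\<lbrakk>provable h s t; provable h t u\<rbrakk> \<Longrightarrow> provable h s u"
| cong_meet: "\<lbrakk>provable h s s'; provable h t t'\<rbrakk> \<Longrightarrow> provable h (s \<^bold>\<and> t) (s' \<^bold>\<and> t')"
| cong_join: "\<lbrakk>provable h s s'; provable h t t'\<rbrakk> \<Longrightarrow> provable h (s \<^bold>\<or> t) (s' \<^bold>\<or> t')"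
| cong_diff: "\<lbrakk>provable h s s'; provable h t t'\<rbrakk> \<Longrightarrow> provable h (s \<^bold>- t) (s' \<^bold>- t')"
| meet_assoc: "provable h ((s \<^bold>\<and> t) \<^bold>\<and> u) (s \<^bold>\<and> (t \<^bold>\<and> u))"
| join_assoc: "provable h ((s \<^bold>\<or> t) \<^bold>\<or> u) (s \<^bold>\<or> (t \<^bold>\<or> u))"
| absorb1: "provable h (s \<^bold>\<and> (s \<^bold>\<or> t)) s"
| absorb2: "provable h ((t \<^bold>\<or> s) \<^bold>\<and> s) s"
| absorb3: "provable h (s \<^bold>\<or> (s \<^bold>\<and> t)) s"
| absorb4: "provable h ((t \<^bold>\<and> s) \<^bold>\<or> s) s"
| distrib_left: "provable h (s \<^bold>\<and> (t \<^bold>\<or> u)) ((s \<^bold>\<and> t) \<^bold>\<or> (s \<^bold>\<and> u))"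
| distrib_right: "provable h ((s \<^bold>\<or> t) \<^bold>\<and> u) ((s \<^bold>\<and> u) \<^bold>\<or> (t \<^bold>\<and> u))"
| zero_meet: "provable h (Zero \<^bold>\<and> s) Zero"
| meet_zero: "provable h (s \<^bold>\<and> Zero) Zero"
| zero_join: "provable h (Zero \<^bold>\<or> s) s"
| join_zero: "provable h (s \<^bold>\<or> Zero) s"
| diff_join: "provable h ((s \<^bold>\<and> t \<^bold>\<and> s) \<^bold>\<or> (s \<^bold>- t)) s"
| diff_meet1: "provable h ((s \<^bold>\<and> t \<^bold>\<and> s) \<^bold>\<and> (s \<^bold>- t)) Zero"
| diff_meet2: "provable h ((s \<^bold>- t) \<^bold>\<and> (s \<^bold>\<and> t \<^bold>\<and> s)) Zero"
| left_meet: "h = LeftHanded \<Longrightarrow> provable h (s \<^bold>\<and> t \<^bold>\<and> s) (s \<^bold>\<and> t)"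
| left_join: "h = LeftHanded \<Longrightarrow> provable h (s \<^bold>\<or> t \<^bold>\<or> s) (t \<^bold>\<or> s)"
| right_meet: "h = RightHanded \<Longrightarrow> provable h (s \<^bold>\<and> t \<^bold>\<and> s) (t \<^bold>\<and> s)"
| right_join: "h = RightHanded \<Longrightarrow> provable h (s \<^bold>\<or> t \<^bold>\<or> s) (s \<^bold>\<or> t)"

definition terms_over :: "'x set \<Rightarrow> 'x sba_term set" where
  "terms_over X = {t. set_sba_term t \<subseteq> X}"

definition provable_rel :: "handedness \<Rightarrow> 'x set \<Rightarrow> ('x sba_term \<times> 'x sba_term) set" where
  "provable_rel h X = {(s, t). s \<in> terms_over X \<and> t \<in> terms_over X \<and> provable h s t}"

definition term_class :: "handedness \<Rightarrow> 'x set \<Rightarrow> 'x sba_term \<Rightarrow> 'x sba_term set" where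
  "term_class h X t = provable_rel h X `` {t}"

definition free_sba :: "handedness \<Rightarrow> 'x set \<Rightarrow> 'x sba_term set skew_alg" where
  "free_sba h X = \<lparr>
     carrier = terms_over X // provable_rel h X,
     meet = (\<lambda>P Q. \<Union>s\<in>P. \<Union>t\<in>Q. term_class h X (s \<^bold>\<and> t)),
     join = (\<lambda>P Q. \<Union>s\<in>P. \<Union>t\<in>Q. term_class h X (s \<^bold>\<or> t)),
     diff = (\<lambda>P Q. \<Union>s\<in>P. \<Union>t\<in>Q. term_class h X (s \<^bold>- t)),
     zero = term_class h X Zero\<rparr>"

abbreviation SBA :: "handedness \<Rightarrow> nat \<Rightarrow> nat sba_term set skew_alg" where
  "SBA h n \<equiv> free_sba h {..<n}"

text \<open>\<open>Gamma_sum n k\<close> is the number \<open>\<Gamma>\<close> with upper index \<open>n\<close> and lower index \<open>k\<close>.\<close>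

definition Gamma_sum :: "nat \<Rightarrow> nat \<Rightarrow> nat" where
  "Gamma_sum n k = (\<Sum>i = k..n. n choose i)"

definition product_of_primitives ::
    "handedness \<Rightarrow> nat \<Rightarrow> (nat \<Rightarrow> nat) \<Rightarrow> (nat \<Rightarrow> nat \<Rightarrow> nat) skew_alg" where
  "product_of_primitives h m \<mu> = product_alg {2..m+1} (\<lambda>k. power_alg (primitive_alg h k) (\<mu> k))"

lemma handed_primitive_alg:
  assumes "k \<ge> 1"
  shows "handed_skew_boolean_algebra (primitive_alg h k) h"
  using assms by unfold_locales (auto simp: primitive_alg_def split: handedness.splits)

lemma handed_product_alg:
  assumes "\<And>i. i \<in> I \<Longrightarrow> handed_skew_boolean_algebra (A i) h"
  shows "handed_skew_boolean_algebra (product_alg I A) h"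
proof -
  note P = handed_skew_boolean_algebra.axioms(1)[OF assms]
  note L = skew_boolean_algebra.axioms(1)[OF P]
  note closed = L[THEN skew_lattice.meet_closed] L[THEN skew_lattice.join_closed]
    P[THEN skew_boolean_algebra.diff_closed] P[THEN skew_boolean_algebra.zero_closed]
  note laws = L[THEN skew_lattice.absorb1] L[THEN skew_lattice.absorb2]
    L[THEN skew_lattice.absorb3] L[THEN skew_lattice.absorb4]
    P[THEN skew_boolean_algebra.distrib_left] P[THEN skew_boolean_algebra.distrib_right]
    P[THEN skew_boolean_algebra.zero_meet] P[THEN skew_boolean_algebra.meet_zero]
    P[THEN skew_boolean_algebra.zero_join] P[THEN skew_boolean_algebra.join_zero]
    P[THEN skew_boolean_algebra.diff_join]
    P[THEN skew_boolean_algebra.diff_meet1] P[THEN skew_boolean_algebra.diff_meet2]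
    assms[THEN handed_skew_boolean_algebra.left_meet]
    assms[THEN handed_skew_boolean_algebra.left_join]
    assms[THEN handed_skew_boolean_algebra.right_meet]
    assms[THEN handed_skew_boolean_algebra.right_join]
  note assocs = L[THEN skew_lattice.meet_assoc] L[THEN skew_lattice.join_assoc]
  have eqI: "restrict f I = x"
    if "x \<in> (\<Pi>\<^sub>E i\<in>I. carrier (A i))" "\<And>i. i \<in> I \<Longrightarrow> f i = x i" for f x
    by (rule PiE_ext[OF _ that(1)]) (use that in \<open>auto simp: PiE_mem\<close>)
  have mem: "x i \<in> carrier (A i)" if "x \<in> (\<Pi>\<^sub>E i\<in>I. carrier (A i))" "i \<in> I" for x i
    using that by (rule PiE_mem)
  show ?thesis
    by (unfold_locales; unfold product_alg_def skew_alg.simps;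
        (unfold restrict_PiE_iff, rule ballI | rule restrict_ext | rule eqI, assumption);
        ((simp only: restrict_apply' mem closed laws; fail)
          | (simp only: restrict_apply' mem closed assocs; fail)))
qed

lemma terms_over_simps [simp]:
  "Var x \<in> terms_over X \<longleftrightarrow> x \<in> X"
  "Zero \<in> terms_over X"
  "s \<^bold>\<and> t \<in> terms_over X \<longleftrightarrow> s \<in> terms_over X \<and> t \<in> terms_over X"
  "s \<^bold>\<or> t \<in> terms_over X \<longleftrightarrow> s \<in> terms_over X \<and> t \<in> terms_over X"
  "s \<^bold>- t \<in> terms_over X \<longleftrightarrow> s \<in> terms_over X \<and> t \<in> terms_over X"
  by (auto simp: terms_over_def)

lemma equiv_provable_rel: "equiv (terms_over X) (provable_rel h X)"
  by (rule equivI)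
     (auto simp: provable_rel_def refl_on_def sym_def trans_def
           intro: provable.refl provable.sym provable.trans)

lemma term_class_eq_iff:
  assumes "s \<in> terms_over X" "t \<in> terms_over X"
  shows "term_class h X s = term_class h X t \<longleftrightarrow> provable h s t"
  using eq_equiv_class_iff[OF equiv_provable_rel assms] assms
  by (auto simp: term_class_def provable_rel_def)

lemma term_class_iff:
  "t \<in> term_class h X s \<longleftrightarrow> s \<in> terms_over X \<and> t \<in> terms_over X \<and> provable h s t"
  by (auto simp: term_class_def provable_rel_def)

lemma free_sba_carrier: "carrier (free_sba h X) = term_class h X ` terms_over X"
  by (auto simp: free_sba_def quotient_def term_class_def)

lemma free_sba_ops:
  assumes "s \<in> terms_over X" "t \<in> terms_over X"
  shows "term_class h X s \<sqinter>\<^bsub>free_sba h X\<^esub> term_class h X t = term_class h X (s \<^bold>\<and> t)"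
    and "term_class h X s \<squnion>\<^bsub>free_sba h X\<^esub> term_class h X t = term_class h X (s \<^bold>\<or> t)"
    and "term_class h X s \<ominus>\<^bsub>free_sba h X\<^esub> term_class h X t = term_class h X (s \<^bold>- t)"
proof -
  have "(\<Union>s'\<in>term_class h X s. \<Union>t'\<in>term_class h X t. term_class h X (c s' t'))
          = term_class h X (c s t)"
    if c: "\<And>s t. c s t \<in> terms_over X \<longleftrightarrow> s \<in> terms_over X \<and> t \<in> terms_over X"
      and cong: "\<And>s s' t t'. \<lbrakk>provable h s s'; provable h t t'\<rbrakk> \<Longrightarrow> provable h (c s t) (c s' t')"
    for c
  proof -
    have "term_class h X (c s' t') = term_class h X (c s t)"
      if "s' \<in> term_class h X s" "t' \<in> term_class h X t" for s' t'
    proof -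
      have *: "s' \<in> terms_over X" "t' \<in> terms_over X" "provable h s' s" "provable h t' t"
        using that by (simp_all add: term_class_iff provable.sym)
      then have "c s' t' \<in> terms_over X" "c s t \<in> terms_over X"
        using assms by (simp_all add: c)
      then show ?thesis
        using cong[OF *(3,4)] by (simp add: term_class_eq_iff)
    qed
    moreover have "s \<in> term_class h X s" "t \<in> term_class h X t"
      using assms by (simp_all add: term_class_iff provable.refl)
    ultimately show ?thesis by blast
  qed
  note * = this
  show "term_class h X s \<sqinter>\<^bsub>free_sba h X\<^esub> term_class h X t = term_class h X (s \<^bold>\<and> t)"
    unfolding free_sba_def skew_alg.simps by (rule *) (auto intro: provable.cong_meet)
  show "term_class h X s \<squnion>\<^bsub>free_sba h X\<^esub> term_class h X t = term_class h X (s \<^bold>\<or> t)"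
    unfolding free_sba_def skew_alg.simps by (rule *) (auto intro: provable.cong_join)
  show "term_class h X s \<ominus>\<^bsub>free_sba h X\<^esub> term_class h X t = term_class h X (s \<^bold>- t)"
    unfolding free_sba_def skew_alg.simps by (rule *) (auto intro: provable.cong_diff)
qed

lemma free_sba_zero: "\<zero>\<^bsub>free_sba h X\<^esub> = term_class h X Zero"
  by (simp add: free_sba_def)

lemma handed_free_sba: "handed_skew_boolean_algebra (free_sba h X) h"
  by (unfold_locales; unfold free_sba_carrier free_sba_zero; (elim imageE)?;
      simp add: free_sba_ops term_class_eq_iff provable.intros(7-))

primrec eval_term :: "('a, 'm) skew_alg_scheme \<Rightarrow> ('x \<Rightarrow> 'a) \<Rightarrow> 'x sba_term \<Rightarrow> 'a" where
  "eval_term A f (Var x) = f x"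
| "eval_term A f Zero = \<zero>\<^bsub>A\<^esub>"
| "eval_term A f (s \<^bold>\<and> t) = eval_term A f s \<sqinter>\<^bsub>A\<^esub> eval_term A f t"
| "eval_term A f (s \<^bold>\<or> t) = eval_term A f s \<squnion>\<^bsub>A\<^esub> eval_term A f t"
| "eval_term A f (s \<^bold>- t) = eval_term A f s \<ominus>\<^bsub>A\<^esub> eval_term A f t"

lemma eval_term_closed:
  assumes "skew_boolean_algebra A" "\<And>x. f x \<in> carrier A"
  shows "eval_term A f t \<in> carrier A"
proof -
  interpret skew_boolean_algebra A by fact
  show ?thesis
    by (induction t)
       (auto simp: assms(2) meet_closed join_closed diff_closed zero_closed)
qed

lemma provable_sound:
  assumes "handed_skew_boolean_algebra A h" "provable h s t" "\<And>x. f x \<in> carrier A"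
  shows "eval_term A f s = eval_term A f t"
proof -
  interpret handed_skew_boolean_algebra A h by fact
  have c: "eval_term A f u \<in> carrier A" for u
    by (rule eval_term_closed) (use assms(3) in \<open>auto intro: skew_boolean_algebra_axioms\<close>)
  note laws = absorb1 absorb2 absorb3 absorb4 distrib_left distrib_right
    zero_meet meet_zero zero_join join_zero diff_join diff_meet1 diff_meet2
    left_meet left_join right_meet right_join
  from assms(2) show ?thesis
    by induction
       ((simp only: eval_term.simps c laws; fail) | (simp add: c meet_assoc join_assoc; fail))+
qed

theorem free_sba_universal:
  assumes A: "handed_skew_boolean_algebra A h" and f: "f \<in> X \<rightarrow> carrier A"
  shows "\<exists>g \<in> hom (free_sba h X) A. \<forall>x \<in> X. g (term_class h X (Var x)) = f x"
    and "\<lbrakk>g1 \<in> hom (free_sba h X) A; g2 \<in> hom (free_sba h X) A;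
          \<And>x. x \<in> X \<Longrightarrow> g1 (term_class h X (Var x)) = g2 (term_class h X (Var x));
          P \<in> carrier (free_sba h X)\<rbrakk> \<Longrightarrow> g1 P = g2 P"
proof -
  interpret handed_skew_boolean_algebra A h by fact
  define f' where "f' x = (if x \<in> X then f x else \<zero>\<^bsub>A\<^esub>)" for x
  have f': "f' x \<in> carrier A" for x
    using f zero_closed by (auto simp: f'_def)
  define g where "g P = eval_term A f' (SOME t. t \<in> P)" for P
  have g: "g (term_class h X t) = eval_term A f' t" if "t \<in> terms_over X" for t
  proof -
    have "(SOME u. u \<in> term_class h X t) \<in> term_class h X t"
      by (rule someI[of _ t]) (simp add: term_class_iff that provable.refl)
    then have "provable h t (SOME u. u \<in> term_class h X t)"
      unfolding term_class_iff[of "SOME u. u \<in> term_class h X t"] by blast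
    from provable_sound[OF A this f'] show ?thesis
      by (simp only: g_def)
  qed
  have "g \<in> hom (free_sba h X) A"
    unfolding hom_def free_sba_carrier free_sba_zero
  proof (intro CollectI conjI ballI Pi_I)
    fix P assume "P \<in> term_class h X ` terms_over X"
    then obtain s where s: "s \<in> terms_over X" "P = term_class h X s" by blast
    then show "g P \<in> carrier A"
      using eval_term_closed[OF skew_boolean_algebra_axioms f'] by (simp add: g)
    fix Q assume "Q \<in> term_class h X ` terms_over X"
    then obtain t where t: "t \<in> terms_over X" "Q = term_class h X t" by blast
    show "g (P \<sqinter>\<^bsub>free_sba h X\<^esub> Q) = g P \<sqinter>\<^bsub>A\<^esub> g Q"
      and "g (P \<squnion>\<^bsub>free_sba h X\<^esub> Q) = g P \<squnion>\<^bsub>A\<^esub> g Q"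
      and "g (P \<ominus>\<^bsub>free_sba h X\<^esub> Q) = g P \<ominus>\<^bsub>A\<^esub> g Q"
      using s t by (simp_all add: free_sba_ops g)
  qed (simp add: g)
  moreover have "\<forall>x \<in> X. g (term_class h X (Var x)) = f x"
    by (simp add: g f'_def)
  ultimately show "\<exists>g \<in> hom (free_sba h X) A. \<forall>x \<in> X. g (term_class h X (Var x)) = f x"
    by blast
next
  assume g: "g1 \<in> hom (free_sba h X) A" "g2 \<in> hom (free_sba h X) A"
    and eq: "\<And>x. x \<in> X \<Longrightarrow> g1 (term_class h X (Var x)) = g2 (term_class h X (Var x))"
    and P: "P \<in> carrier (free_sba h X)"
  have carrier: "term_class h X t \<in> carrier (free_sba h X)" if "t \<in> terms_over X" for t
    using that by (simp add: free_sba_carrier)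
  have ops: "g (term_class h X (s \<^bold>\<and> t)) = g (term_class h X s) \<sqinter>\<^bsub>A\<^esub> g (term_class h X t)"
      "g (term_class h X (s \<^bold>\<or> t)) = g (term_class h X s) \<squnion>\<^bsub>A\<^esub> g (term_class h X t)"
      "g (term_class h X (s \<^bold>- t)) = g (term_class h X s) \<ominus>\<^bsub>A\<^esub> g (term_class h X t)"
      "g (term_class h X Zero) = \<zero>\<^bsub>A\<^esub>"
    if "g \<in> hom (free_sba h X) A" "s \<in> terms_over X" "t \<in> terms_over X" for g s t
    using that carrier[OF that(2)] carrier[OF that(3)] unfolding hom_def
    by (simp_all add: free_sba_ops[symmetric] free_sba_zero[symmetric])
  have "t \<in> terms_over X \<Longrightarrow> g1 (term_class h X t) = g2 (term_class h X t)" for t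
  proof (induction t)
    case Zero
    show ?case using ops(4)[OF g(1) Zero Zero] ops(4)[OF g(2) Zero Zero] by simp
  qed (simp_all add: eq ops(1-3)[OF g(1)] ops(1-3)[OF g(2)])
  then show "g1 P = g2 P"
    using P by (auto simp: free_sba_carrier)
qed

end

theory Submission
  imports Defs
begin

text \<open>An algebra is a homomorphic image of the free algebra on \<open>X\<close> exactly when some family
  \<open>f\<close> of its elements indexed by \<open>X\<close> generates it (\<open>hom_image_free_iff_generating_family\<close>), so the
  question is when a finite product of primitive algebras has a generating family indexed by \<open>n\<close>
  elements. Attach to each coordinate \<open>i\<close> of the product its support, the set of those \<open>x\<close> for
  which \<open>f x\<close> is nonzero at \<open>i\<close>. The family generates if and only if every coordinate takes all
  its nonzero values on the family and different coordinates have different supports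
  (\<open>generating_family_necessary\<close>, \<open>generating_family_sufficient\<close>). Neither condition mentions the
  handedness, so both cases are treated at once.

  A coordinate in a factor with \<open>j\<close> elements can take its \<open>j - 1\<close> nonzero values exactly when its
  support has at least \<open>j - 1\<close> elements. Generating families therefore exist if and only if the
  coordinates can be matched injectively with subsets of the index set, each large enough for its
  coordinate. Since a subset that is large enough for one coordinate is large enough for all less
  demanding ones, Hall's condition only has to be checked for the coordinates above a threshold
  (\<open>threshold_matching\<close>). There are \<open>Gamma_sum n k\<close> subsets with at least \<open>k\<close> elements, and
  \<open>\<mu> (k + 1) + \<dots> + \<mu> (m + 1)\<close> coordinates that require at least \<open>k\<close> elements; comparing these
  numbers gives the stated inequalities.\<close>

section \<open>Homomorphic images of free algebras and generating families\<close>

lemma homD: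
  assumes "f \<in> hom A B"
  shows "x \<in> carrier A \<Longrightarrow> f x \<in> carrier B"
    and "\<lbrakk>x \<in> carrier A; y \<in> carrier A\<rbrakk> \<Longrightarrow> f (x \<sqinter>\<^bsub>A\<^esub> y) = f x \<sqinter>\<^bsub>B\<^esub> f y"
    and "\<lbrakk>x \<in> carrier A; y \<in> carrier A\<rbrakk> \<Longrightarrow> f (x \<squnion>\<^bsub>A\<^esub> y) = f x \<squnion>\<^bsub>B\<^esub> f y"
    and "\<lbrakk>x \<in> carrier A; y \<in> carrier A\<rbrakk> \<Longrightarrow> f (x \<ominus>\<^bsub>A\<^esub> y) = f x \<ominus>\<^bsub>B\<^esub> f y"
    and "f \<zero>\<^bsub>A\<^esub> = \<zero>\<^bsub>B\<^esub>"
  using assms by (auto simp: hom_def)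

lemma homI:
  assumes "\<And>x. x \<in> carrier A \<Longrightarrow> f x \<in> carrier B"
    and "\<And>x y. \<lbrakk>x \<in> carrier A; y \<in> carrier A\<rbrakk> \<Longrightarrow> f (x \<sqinter>\<^bsub>A\<^esub> y) = f x \<sqinter>\<^bsub>B\<^esub> f y"
    and "\<And>x y. \<lbrakk>x \<in> carrier A; y \<in> carrier A\<rbrakk> \<Longrightarrow> f (x \<squnion>\<^bsub>A\<^esub> y) = f x \<squnion>\<^bsub>B\<^esub> f y"
    and "\<And>x y. \<lbrakk>x \<in> carrier A; y \<in> carrier A\<rbrakk> \<Longrightarrow> f (x \<ominus>\<^bsub>A\<^esub> y) = f x \<ominus>\<^bsub>B\<^esub> f y"
    and "f \<zero>\<^bsub>A\<^esub> = \<zero>\<^bsub>B\<^esub>"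
  shows "f \<in> hom A B"
  using assms by (auto simp: hom_def)

lemma is_hom_image_of_trans:
  assumes "is_hom_image_of C B" "is_hom_image_of B A"
  shows "is_hom_image_of C A"
proof -
  obtain f g where f: "f \<in> hom A B" "f ` carrier A = carrier B"
    and g: "g \<in> hom B C" "g ` carrier B = carrier C"
    using assms by (auto simp: is_hom_image_of_def)
  have "g \<circ> f \<in> hom A C"
    by (rule homI) (simp_all add: homD[OF f(1)] homD[OF g(1)])
  moreover have "(g \<circ> f) ` carrier A = carrier C"
    using f(2) g(2) by (metis image_comp)
  ultimately show ?thesis
    unfolding is_hom_image_of_def by blast
qed

lemma generated_subset:
  assumes "skew_boolean_algebra A" "G \<subseteq> carrier A"
  shows "generated A G \<subseteq> carrier A"
proof
  interpret skew_boolean_algebra A by fact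
  fix x assume "x \<in> generated A G"
  then show "x \<in> carrier A"
    by induction
       (use assms(2) in \<open>auto intro: meet_closed join_closed diff_closed zero_closed\<close>)
qed

lemma hom_image_free_eq_generated:
  assumes g: "g \<in> hom (free_sba h X) A"
  shows "g ` carrier (free_sba h X) = generated A ((\<lambda>x. g (term_class h X (Var x))) ` X)"
    (is "_ = generated A ?G")
proof
  have c: "term_class h X t \<in> carrier (free_sba h X)" if "t \<in> terms_over X" for t
    using that by (simp add: free_sba_carrier)
  have ops: "g (term_class h X (s \<^bold>\<and> t)) = g (term_class h X s) \<sqinter>\<^bsub>A\<^esub> g (term_class h X t)"
      "g (term_class h X (s \<^bold>\<or> t)) = g (term_class h X s) \<squnion>\<^bsub>A\<^esub> g (term_class h X t)"
      "g (term_class h X (s \<^bold>- t)) = g (term_class h X s) \<ominus>\<^bsub>A\<^esub> g (term_class h X t)"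
    if "s \<in> terms_over X" "t \<in> terms_over X" for s t
    using that homD(2-4)[OF g c[OF that(1)] c[OF that(2)]] by (simp_all add: free_sba_ops)
  have zero: "g (term_class h X Zero) = \<zero>\<^bsub>A\<^esub>"
    using homD(5)[OF g] by (simp add: free_sba_zero)
  have "g (term_class h X t) \<in> generated A ?G" if "t \<in> terms_over X" for t
    using that
    by (induction t) (auto simp: ops zero intro: generated.intros)
  then show "g ` carrier (free_sba h X) \<subseteq> generated A ?G"
    by (auto simp: free_sba_carrier)
  have image: "\<exists>t \<in> terms_over X. y = g (term_class h X t)" if "y \<in> generated A ?G" for y
    using that
  proof induction
    case (gen_base y)
    then obtain x where "x \<in> X" "y = g (term_class h X (Var x))" by blast
    then show ?case by (intro bexI[of _ "Var x"]) simp_all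
  next
    case gen_zero
    show ?case by (intro bexI[of _ Zero]) (simp_all add: zero)
  next
    case (gen_meet y z)
    then show ?case by (metis ops(1) terms_over_simps(3))
  next
    case (gen_join y z)
    then show ?case by (metis ops(2) terms_over_simps(4))
  next
    case (gen_diff y z)
    then show ?case by (metis ops(3) terms_over_simps(5))
  qed
  show "generated A ?G \<subseteq> g ` carrier (free_sba h X)"
    unfolding free_sba_carrier using image by blast
qed

text \<open>By the universal property a homomorphism may send the free generators anywhere, and its
  range is what their images generate.\<close>

lemma hom_image_free_iff_generating_family:
  assumes A: "handed_skew_boolean_algebra A h"
  shows "is_hom_image_of A (free_sba h X)
         \<longleftrightarrow> (\<exists>f \<in> X \<rightarrow> carrier A. generated A (f ` X) = carrier A)"
proof
  assume "is_hom_image_of A (free_sba h X)"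
  then obtain g where g: "g \<in> hom (free_sba h X) A" "g ` carrier (free_sba h X) = carrier A"
    by (auto simp: is_hom_image_of_def)
  have "(\<lambda>x. g (term_class h X (Var x))) \<in> X \<rightarrow> carrier A"
    by (auto intro!: homD(1)[OF g(1)] simp: free_sba_carrier)
  with g show "\<exists>f \<in> X \<rightarrow> carrier A. generated A (f ` X) = carrier A"
    using hom_image_free_eq_generated[OF g(1)] by metis
next
  assume "\<exists>f \<in> X \<rightarrow> carrier A. generated A (f ` X) = carrier A"
  then obtain f where f: "f \<in> X \<rightarrow> carrier A" "generated A (f ` X) = carrier A" by blast
  obtain g where g: "g \<in> hom (free_sba h X) A" "\<forall>x \<in> X. g (term_class h X (Var x)) = f x"
    using free_sba_universal(1)[OF A f(1)] by blast
  have "(\<lambda>x. g (term_class h X (Var x))) ` X = f ` X"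
    using g(2) by (intro image_cong) auto
  then show "is_hom_image_of A (free_sba h X)"
    using hom_image_free_eq_generated[OF g(1)] f(2) g(1)
    unfolding is_hom_image_of_def by metis
qed

lemma hom_image_SBA_card:
  assumes A: "handed_skew_boolean_algebra A h"
    and G: "G \<subseteq> carrier A" "finite G" "generated A G = carrier A"
  shows "is_hom_image_of A (SBA h (card G))"
proof -
  obtain f where f: "bij_betw f {..<card G} G"
    using ex_bij_betw_nat_finite[OF G(2)] by (auto simp: atLeast0LessThan)
  then have "f ` {..<card G} = G" by (simp add: bij_betw_def)
  with G show ?thesis
    unfolding hom_image_free_iff_generating_family[OF A]
    by (intro bexI[of _ f]) auto
qed

text \<open>A generating family indexed by \<open>n\<close> elements may repeat values, so its range gives a
  generating set of at most \<open>n\<close> elements, and conversely a finite generating set can be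
  enumerated. This is enough for the two minima to agree.\<close>

lemma Least_hom_image_SBA_eq_rank:
  assumes A: "handed_skew_boolean_algebra A h" and ex: "\<exists>n. is_hom_image_of A (SBA h n)"
  shows "(LEAST n. is_hom_image_of A (SBA h n)) = rank A"
proof (rule antisym)
  let ?gen = "\<lambda>n. \<exists>G \<subseteq> carrier A. finite G \<and> card G = n \<and> generated A G = carrier A"
  let ?n = "LEAST n. is_hom_image_of A (SBA h n)"
  have "is_hom_image_of A (SBA h ?n)"
    using ex by (rule LeastI_ex)
  then obtain f where f: "f \<in> {..<?n} \<rightarrow> carrier A" "generated A (f ` {..<?n}) = carrier A"
    unfolding hom_image_free_iff_generating_family[OF A] by blast
  then have gen: "?gen (card (f ` {..<?n}))" by blast
  have "rank A \<le> card (f ` {..<?n})"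
    unfolding rank_def by (rule Least_le) (rule gen)
  also have "\<dots> \<le> ?n"
    using card_image_le[of "{..<?n}" f] by simp
  finally show "rank A \<le> ?n" .
  have "?gen (rank A)"
    unfolding rank_def by (rule LeastI) (rule gen)
  then obtain G where "G \<subseteq> carrier A" "finite G" "card G = rank A" "generated A G = carrier A"
    by blast
  then have "is_hom_image_of A (SBA h (rank A))"
    using hom_image_SBA_card[OF A, of G] by simp
  then show "?n \<le> rank A" by (rule Least_le)
qed

lemma finite_imp_hom_image_SBA:
  assumes A: "handed_skew_boolean_algebra A h" and "finite (carrier A)"
  shows "\<exists>n. is_hom_image_of A (SBA h n)"
proof -
  have "generated A (carrier A) = carrier A"
    using generated_subset[OF handed_skew_boolean_algebra.axioms(1)[OF A]]
    by (auto intro: generated.gen_base)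
  with assms show ?thesis
    using hom_image_SBA_card[OF A subset_refl] by blast
qed

section \<open>Iterated products\<close>

text \<open>The operations of a product are computed coordinatewise, so currying and uncurrying are
  mutually inverse isomorphisms between an iterated product and the product over the disjoint
  union of the index sets.\<close>

lemma product_alg_Sigma_hom_image:
  fixes I :: "'i set" and J :: "'i \<Rightarrow> 'j set" and A :: "'i \<Rightarrow> 'j \<Rightarrow> 'a skew_alg"
  defines "B \<equiv> product_alg I (\<lambda>i. product_alg (J i) (A i))"
    and "C \<equiv> product_alg (Sigma I J) (\<lambda>(i, j). A i j)"
  shows "is_hom_image_of C B" and "is_hom_image_of B C"
proof -
  define \<phi> :: "('i \<Rightarrow> 'j \<Rightarrow> 'a) \<Rightarrow> 'i \<times> 'j \<Rightarrow> 'a"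
    where "\<phi> x = (\<lambda>(i, j)\<in>Sigma I J. x i j)" for x
  define \<psi> :: "('i \<times> 'j \<Rightarrow> 'a) \<Rightarrow> 'i \<Rightarrow> 'j \<Rightarrow> 'a"
    where "\<psi> y = (\<lambda>i\<in>I. \<lambda>j\<in>J i. y (i, j))" for y
  note defs = B_def C_def \<phi>_def \<psi>_def product_alg_def
  have \<phi>: "\<phi> \<in> hom B C"
    by (rule homI) (auto simp: defs PiE_iff fun_eq_iff)
  have \<psi>: "\<psi> \<in> hom C B"
    by (rule homI) (auto simp: defs PiE_iff fun_eq_iff)
  have \<phi>\<psi>: "\<phi> (\<psi> y) = y" if "y \<in> carrier C" for y
    using that by (auto simp: defs PiE_iff fun_eq_iff extensional_def)
  have \<psi>\<phi>: "\<psi> (\<phi> x) = x" if "x \<in> carrier B" for x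
    using that by (auto simp: defs PiE_iff fun_eq_iff extensional_def)
  have "\<phi> ` carrier B = carrier C"
    using homD(1)[OF \<phi>] homD(1)[OF \<psi>] \<phi>\<psi> by (metis image_eqI image_subsetI subsetI subset_antisym)
  then show "is_hom_image_of C B"
    using \<phi> by (auto simp: is_hom_image_of_def)
  have "\<psi> ` carrier C = carrier B"
    using homD(1)[OF \<phi>] homD(1)[OF \<psi>] \<psi>\<phi> by (metis image_eqI image_subsetI subsetI subset_antisym)
  then show "is_hom_image_of B C"
    using \<psi> by (auto simp: is_hom_image_of_def)
qed

section \<open>Generating families of a product of primitive algebras\<close>

lemma product_primitive_simps:
  "carrier (product_alg I (\<lambda>i. primitive_alg h (\<kappa> i))) = (\<Pi>\<^sub>E i\<in>I. {0..<\<kappa> i})"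
  "i \<in> I \<Longrightarrow> (x \<sqinter>\<^bsub>product_alg I (\<lambda>i. primitive_alg h (\<kappa> i))\<^esub> y) i =
     (if x i = 0 \<or> y i = 0 then 0 else case h of LeftHanded \<Rightarrow> x i | RightHanded \<Rightarrow> y i)"
  "i \<in> I \<Longrightarrow> (x \<squnion>\<^bsub>product_alg I (\<lambda>i. primitive_alg h (\<kappa> i))\<^esub> y) i =
     (if x i = 0 then y i else if y i = 0 then x i
      else case h of LeftHanded \<Rightarrow> y i | RightHanded \<Rightarrow> x i)"
  "i \<in> I \<Longrightarrow> (x \<ominus>\<^bsub>product_alg I (\<lambda>i. primitive_alg h (\<kappa> i))\<^esub> y) i =
     (if y i = 0 then x i else 0)"
  "i \<in> I \<Longrightarrow> \<zero>\<^bsub>product_alg I (\<lambda>i. primitive_alg h (\<kappa> i))\<^esub> i = 0"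
  by (simp_all add: product_alg_def primitive_alg_def)

text \<open>Two obstructions to generating: each operation on a primitive algebra returns one of its
  arguments or \<open>0\<close>, so a coordinate never shows a nonzero value that no generator shows; and
  whether a result is \<open>0\<close> depends only on which arguments are \<open>0\<close>, so two coordinates at which
  the same generators vanish vanish together throughout the generated subalgebra.\<close>

lemma generating_family_necessary:
  fixes f :: "'x \<Rightarrow> 'i \<Rightarrow> nat" and \<kappa> :: "'i \<Rightarrow> nat" and h :: handedness and I :: "'i set"
  defines "S \<equiv> product_alg I (\<lambda>i. primitive_alg h (\<kappa> i))"
  assumes \<kappa>: "\<And>i. i \<in> I \<Longrightarrow> \<kappa> i \<ge> 2"
    and gen: "generated S (f ` X) = carrier S"
  shows "\<forall>i\<in>I. {1..<\<kappa> i} \<subseteq> (\<lambda>x. f x i) ` X"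
    and "inj_on (\<lambda>i. {x \<in> X. f x i \<noteq> 0}) I"
proof -
  note simps = product_primitive_simps[where I = I and h = h and \<kappa> = \<kappa>, folded S_def]
  have pos: "0 < \<kappa> i" "1 < \<kappa> i" if "i \<in> I" for i
    using \<kappa>[OF that] by simp_all
  show "\<forall>i\<in>I. {1..<\<kappa> i} \<subseteq> (\<lambda>x. f x i) ` X"
  proof (intro ballI subsetI)
    fix i v assume i: "i \<in> I" and v: "v \<in> {1..<\<kappa> i}"
    have shown: "y i = 0 \<or> y i \<in> (\<lambda>x. f x i) ` X" if "y \<in> generated S (f ` X)" for y
      using that by induction (auto simp: simps i split: handedness.split)
    have "(\<lambda>j\<in>I. if j = i then v else 0) \<in> carrier S"
      using v pos by (auto simp: simps)
    from shown[OF this[folded gen]] show "v \<in> (\<lambda>x. f x i) ` X"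
      using v i by simp
  qed
  show "inj_on (\<lambda>i. {x \<in> X. f x i \<noteq> 0}) I"
  proof (rule inj_onI, rule ccontr)
    fix i j assume ij: "i \<in> I" "j \<in> I" "{x \<in> X. f x i \<noteq> 0} = {x \<in> X. f x j \<noteq> 0}" "i \<noteq> j"
    have eq: "f x i = 0 \<longleftrightarrow> f x j = 0" if "x \<in> X" for x
      using that ij(3) by blast
    have vanish: "y i = 0 \<longleftrightarrow> y j = 0" if "y \<in> generated S (f ` X)" for y
      using that by induction (auto simp: simps eq ij split: handedness.split)
    have "(\<lambda>l\<in>I. if l = i then 1 else 0) \<in> carrier S"
      using pos by (auto simp: simps)
    from vanish[OF this[folded gen]] show False
      using ij by simp
  qed
qed

text \<open>Conversely, generators with these two properties produce every element. A generator with
  the wanted value at \<open>i\<close> is cleared at the other coordinates one at a time: since the supports of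
  \<open>i\<close> and \<open>j\<close> differ, some generator vanishes at exactly one of the two, and subtracting it, or
  restricting to its support, clears \<open>j\<close> and preserves the value at \<open>i\<close>. Coordinates already
  cleared stay \<open>0\<close>. The resulting elements are supported on single coordinates, and joining them
  builds up an arbitrary element.\<close>

lemma generating_family_sufficient:
  fixes f :: "'x \<Rightarrow> 'i \<Rightarrow> nat" and \<kappa> :: "'i \<Rightarrow> nat" and h :: handedness and I :: "'i set"
  defines "S \<equiv> product_alg I (\<lambda>i. primitive_alg h (\<kappa> i))"
  assumes fin: "finite I" and \<kappa>: "\<And>i. i \<in> I \<Longrightarrow> \<kappa> i \<ge> 1"
    and f: "f \<in> X \<rightarrow> carrier S"
    and onto: "\<And>i. i \<in> I \<Longrightarrow> {1..<\<kappa> i} \<subseteq> (\<lambda>x. f x i) ` X"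
    and inj: "inj_on (\<lambda>i. {x \<in> X. f x i \<noteq> 0}) I"
  shows "generated S (f ` X) = carrier S"
proof
  note simps = product_primitive_simps[where I = I and h = h and \<kappa> = \<kappa>, folded S_def]
  let ?G = "generated S (f ` X)"
  have "handed_skew_boolean_algebra S h"
    unfolding S_def by (intro handed_product_alg handed_primitive_alg \<kappa>)
  then show sub: "?G \<subseteq> carrier S"
    using f by (intro generated_subset handed_skew_boolean_algebra.axioms(1)) auto
  have eqI: "x = y" if "x \<in> ?G" "y \<in> carrier S" "\<And>i. i \<in> I \<Longrightarrow> x i = y i" for x y
    using that sub by (intro PiE_ext[of x I "\<lambda>i. {0..<\<kappa> i}" y]) (auto simp: simps)
  have isolate: "\<exists>y \<in> ?G. y i = v \<and> (\<forall>j \<in> J. y j = 0)"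
    if "finite J" "J \<subseteq> I - {i}" and i: "i \<in> I" and v: "v \<in> {1..<\<kappa> i}" for i v J
    using that(1,2)
  proof induction
    case empty
    obtain x where "x \<in> X" "f x i = v"
      using onto[OF i] v by blast
    then show ?case by (auto intro!: bexI[of _ "f x"] generated.gen_base)
  next
    case (insert j J)
    then obtain y where y: "y \<in> ?G" "y i = v" "\<forall>j \<in> J. y j = 0" by auto
    have j: "j \<in> I" and J: "J \<subseteq> I" and "j \<noteq> i" using insert.prems by auto
    then have neq: "{x \<in> X. f x i \<noteq> 0} \<noteq> {x \<in> X. f x j \<noteq> 0}"
      using inj_onD[OF inj _ i j] by metis
    have "\<exists>x \<in> X. (f x i = 0) \<noteq> (f x j = 0)"
    proof (rule ccontr)
      assume "\<not> ?thesis"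
      then have "{x \<in> X. f x i \<noteq> 0} = {x \<in> X. f x j \<noteq> 0}" by auto
      with neq show False ..
    qed
    then obtain x where x: "x \<in> X" and xij: "(f x i = 0) \<noteq> (f x j = 0)" ..
    from x have gx: "f x \<in> ?G" by (intro generated.gen_base imageI)
    from xij consider "f x i = 0" "f x j \<noteq> 0" | "f x i \<noteq> 0" "f x j = 0"
      by (cases "f x i = 0") auto
    then show ?case
    proof cases
      case 1
      have "y \<ominus>\<^bsub>S\<^esub> f x \<in> ?G"
        using y(1) gx by (rule generated.gen_diff)
      then show ?thesis
        using 1 y i j J by (intro bexI[of _ "y \<ominus>\<^bsub>S\<^esub> f x"]) (auto simp: simps subset_iff)
    next
      case 2
      \<comment> \<open>The double difference restricts \<open>y\<close> to the support of \<open>f x\<close> and keeps the values of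
        \<open>y\<close> there, for either handedness.\<close>
      let ?z = "y \<ominus>\<^bsub>S\<^esub> (y \<ominus>\<^bsub>S\<^esub> f x)"
      have "?z \<in> ?G"
        using y(1) gx by (intro generated.gen_diff)
      then show ?thesis
        using 2 y i j J v by (intro bexI[of _ ?z]) (auto simp: simps subset_iff)
    qed
  qed
  show "carrier S \<subseteq> ?G"
  proof
    fix y assume y: "y \<in> carrier S"
    have "\<exists>z \<in> ?G. \<forall>i \<in> I. z i = (if i \<in> J then y i else 0)" if "finite J" "J \<subseteq> I" for J
      using that
    proof induction
      case empty
      show ?case by (rule bexI[OF _ generated.gen_zero]) (simp add: simps)
    next
      case (insert i J)
      then obtain z where z: "z \<in> ?G" "\<forall>i \<in> I. z i = (if i \<in> J then y i else 0)" by auto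
      show ?case
      proof (cases "y i = 0")
        case True
        with z show ?thesis by (intro bexI[of _ z]) auto
      next
        case False
        then have "y i \<in> {1..<\<kappa> i}"
          using y insert.prems by (auto simp: simps PiE_iff Pi_iff)
        then obtain e where e: "e \<in> ?G" "e i = y i" "\<forall>j \<in> I - {i}. e j = 0"
          using isolate[of "I - {i}" i "y i"] fin insert.prems by auto
        have e0: "e j = 0" if "j \<in> I" "j \<noteq> i" for j
          using e(3) that by blast
        have "z \<squnion>\<^bsub>S\<^esub> e \<in> ?G"
          using z(1) e(1) by (rule generated.gen_join)
        moreover have "(z \<squnion>\<^bsub>S\<^esub> e) j = (if j \<in> insert i J then y j else 0)" if j: "j \<in> I" for j
          using z(2) e(2) e0[OF j] insert.hyps(2) j by (cases "j = i") (simp_all add: simps)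
        ultimately show ?thesis by blast
      qed
    qed
    from this[OF fin subset_refl] obtain z where "z \<in> ?G" "\<forall>i \<in> I. z i = y i" by auto
    then show "y \<in> ?G" using eqI[of z y] y by auto
  qed
qed

section \<open>Assigning supports\<close>

text \<open>Hall's marriage theorem for demands that are linearly ordered. A greedy choice suffices: the
  element with the smallest demand is matched last, and what all the others have received also
  satisfies its demand, so counting the candidates at that one level shows that one is left.\<close>

lemma threshold_matching:
  fixes d :: "'i \<Rightarrow> nat" and w :: "'p \<Rightarrow> nat"
  assumes "finite I" and P: "finite P"
    and "\<And>k. card {i \<in> I. k \<le> d i} \<le> card {p \<in> P. k \<le> w p}"
  shows "\<exists>T \<in> I \<rightarrow> P. inj_on T I \<and> (\<forall>i \<in> I. d i \<le> w (T i))"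
  using assms(1,3)
proof (induction rule: finite_ranking_induct[where f = "\<lambda>i. - int (d i)"])
  case empty
  then show ?case by simp
next
  case (insert i I)
  show ?case
  proof (cases "i \<in> I")
    case True
    with insert show ?thesis by (simp add: insert_absorb)
  next
    case False
    have "card {j \<in> I. k \<le> d j} \<le> card {p \<in> P. k \<le> w p}" for k
    proof -
      have "card {j \<in> I. k \<le> d j} \<le> card {j \<in> insert i I. k \<le> d j}"
        using insert.hyps(1) by (intro card_mono) auto
      also note insert.prems[of k]
      finally show ?thesis .
    qed
    then obtain T where T: "T \<in> I \<rightarrow> P" "inj_on T I" "\<forall>j \<in> I. d j \<le> w (T j)"
      using insert.IH by blast
    have "{j \<in> insert i I. d i \<le> d j} = insert i I"
      using insert.hyps by auto
    then have "card (T ` I) < card {p \<in> P. d i \<le> w p}"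
      using insert.prems[of "d i"] insert.hyps(1) False T(2) by (simp add: card_image)
    then have "\<not> {p \<in> P. d i \<le> w p} \<subseteq> T ` I"
      using card_mono[of "T ` I" "{p \<in> P. d i \<le> w p}"] insert.hyps(1) by auto
    then obtain p where p: "p \<in> P" "d i \<le> w p" "p \<notin> T ` I" by blast
    show ?thesis
    proof (intro bexI[of _ "T(i := p)"] conjI)
      show "inj_on (T(i := p)) (insert i I)"
        using T(2) p(3) False by (auto simp: inj_on_def)
    qed (use T p False in auto)
  qed
qed

text \<open>A matching of the coordinates with sufficiently large subsets of \<open>X\<close> becomes a generating
  family by mapping each subset onto the nonzero values of its coordinate.\<close>

lemma hom_image_product_primitive_iff:
  fixes \<kappa> :: "'i \<Rightarrow> nat" and X :: "'x set"
  assumes fin: "finite I" "finite X" and \<kappa>: "\<And>i. i \<in> I \<Longrightarrow> \<kappa> i \<ge> 2"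
  shows "is_hom_image_of (product_alg I (\<lambda>i. primitive_alg h (\<kappa> i))) (free_sba h X)
         \<longleftrightarrow> (\<forall>k. card {i \<in> I. k + 1 \<le> \<kappa> i} \<le> card {T. T \<subseteq> X \<and> k \<le> card T})"
    (is "is_hom_image_of ?S _ \<longleftrightarrow> ?count")
proof -
  have "handed_skew_boolean_algebra ?S h"
    using \<kappa> by (intro handed_product_alg handed_primitive_alg) force
  note iff = hom_image_free_iff_generating_family[OF this]
  show ?thesis
  proof
    assume "is_hom_image_of ?S (free_sba h X)"
    then obtain f where "generated ?S (f ` X) = carrier ?S"
      unfolding iff by blast
    note f = generating_family_necessary[OF \<kappa> this]
    let ?T = "\<lambda>i. {x \<in> X. f x i \<noteq> 0}"
    have large: "\<kappa> i - 1 \<le> card (?T i)" if "i \<in> I" for i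
    proof -
      have "{1..<\<kappa> i} \<subseteq> (\<lambda>x. f x i) ` ?T i"
        using f(1) that by force
      then have "card {1..<\<kappa> i} \<le> card (?T i)"
        using fin(2) by (intro surj_card_le) auto
      then show ?thesis by simp
    qed
    show ?count
    proof
      fix k
      show "card {i \<in> I. k + 1 \<le> \<kappa> i} \<le> card {T. T \<subseteq> X \<and> k \<le> card T}"
      proof (rule card_inj_on_le[of ?T])
        show "inj_on ?T {i \<in> I. k + 1 \<le> \<kappa> i}"
          using f(2) by (rule inj_on_subset) auto
        show "?T ` {i \<in> I. k + 1 \<le> \<kappa> i} \<subseteq> {T. T \<subseteq> X \<and> k \<le> card T}"
          using large by fastforce
      qed (use fin(2) in auto)
    qed
  next
    assume count: ?count
    have "\<exists>T \<in> I \<rightarrow> Pow X. inj_on T I \<and> (\<forall>i \<in> I. \<kappa> i - 1 \<le> card (T i))"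
    proof (rule threshold_matching)
      fix k
      have "{i \<in> I. k \<le> \<kappa> i - 1} = {i \<in> I. k + 1 \<le> \<kappa> i}"
        using \<kappa> by force
      then show "card {i \<in> I. k \<le> \<kappa> i - 1} \<le> card {T \<in> Pow X. k \<le> card T}"
        using count by simp
    qed (use fin in auto)
    then obtain T where T: "T \<in> I \<rightarrow> Pow X" "inj_on T I" "\<And>i. i \<in> I \<Longrightarrow> \<kappa> i - 1 \<le> card (T i)"
      by blast
    have "\<exists>g. g ` T i = {1..<\<kappa> i}" if i: "i \<in> I" for i
    proof -
      have "finite (T i)"
        using T(1) i fin(2) by (auto intro: finite_subset)
      moreover have "card {1..<\<kappa> i} \<le> card (T i)" "{1..<\<kappa> i} \<noteq> {}"
        using T(3)[OF i] \<kappa>[OF i] by auto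
      ultimately show ?thesis
        using card_le_inj[of "{1..<\<kappa> i}" "T i"] inj_on_iff_surj[of "{1..<\<kappa> i}" "T i"] by auto
    qed
    then obtain g where g: "\<And>i. i \<in> I \<Longrightarrow> g i ` T i = {1..<\<kappa> i}" by metis
    define f where "f x = (\<lambda>i\<in>I. if x \<in> T i then g i x else 0)" for x
    have val: "g i x \<noteq> 0" "g i x < \<kappa> i" if "i \<in> I" "x \<in> T i" for i x
    proof -
      have "g i x \<in> {1..<\<kappa> i}"
        unfolding g[OF that(1), symmetric] using that(2) by (rule imageI)
      then show "g i x \<noteq> 0" "g i x < \<kappa> i" by simp_all
    qed
    have supp: "{x \<in> X. f x i \<noteq> 0} = T i" if "i \<in> I" for i
    proof -
      have "T i \<subseteq> X" using T(1) that by auto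
      then show ?thesis
        using that val by (auto simp: f_def)
    qed
    have "f \<in> X \<rightarrow> carrier ?S"
    proof
      fix x
      have "f x i < \<kappa> i" if "i \<in> I" for i
        using val[OF that] \<kappa>[OF that] that by (simp add: f_def)
      then show "f x \<in> carrier ?S"
        by (auto simp: product_primitive_simps PiE_iff f_def)
    qed
    moreover have "generated ?S (f ` X) = carrier ?S"
    proof (rule generating_family_sufficient)
      show "{1..<\<kappa> i} \<subseteq> (\<lambda>x. f x i) ` X" if i: "i \<in> I" for i
      proof -
        have "{1..<\<kappa> i} = (\<lambda>x. f x i) ` T i"
          using g[OF i] i by (auto simp: f_def)
        also have "\<dots> \<subseteq> (\<lambda>x. f x i) ` X"
          using T(1) i by auto
        finally show ?thesis .
      qed
      show "inj_on (\<lambda>i. {x \<in> X. f x i \<noteq> 0}) I"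
        using T(2) supp by (simp add: inj_on_def)
      show "f \<in> X \<rightarrow> carrier ?S" by fact
    qed (use fin(1) \<kappa> in force)+
    ultimately show "is_hom_image_of ?S (free_sba h X)"
      unfolding iff by blast
  qed
qed

lemma card_large_subsets: "card {T. T \<subseteq> {..<n} \<and> k \<le> card T} = Gamma_sum n k"
proof -
  have "card T \<le> n" if "T \<subseteq> {..<n}" for T
    using card_mono[OF finite_lessThan that] by simp
  then have "{T. T \<subseteq> {..<n} \<and> k \<le> card T} = (\<Union>i\<in>{k..n}. {T. T \<subseteq> {..<n} \<and> card T = i})"
    by auto
  also have "card \<dots> = (\<Sum>i = k..n. card {T. T \<subseteq> {..<n} \<and> card T = i})"
    by (rule card_UN_disjoint) auto
  finally show ?thesis
    by (simp add: Gamma_sum_def n_subsets)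
qed

lemma hom_image_product_of_primitives_iff:
  "is_hom_image_of (product_of_primitives h m \<mu>) (SBA h n)
   \<longleftrightarrow> (\<forall>k\<in>{1..m}. (\<Sum>j = k+1..m+1. \<mu> j) \<le> Gamma_sum n k)"
proof -
  let ?I = "SIGMA k:{2..m+1}. {..<\<mu> k}"
  let ?C = "product_alg ?I (\<lambda>i. primitive_alg h (fst i))"
  have flat: "is_hom_image_of ?C (product_of_primitives h m \<mu>)"
    "is_hom_image_of (product_of_primitives h m \<mu>) ?C"
    using product_alg_Sigma_hom_image[of "{2..m+1}" "\<lambda>k. {..<\<mu> k}" "\<lambda>k _. primitive_alg h k"]
    unfolding product_of_primitives_def power_alg_def case_prod_unfold .
  have "is_hom_image_of (product_of_primitives h m \<mu>) (SBA h n) \<longleftrightarrow> is_hom_image_of ?C (SBA h n)"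
    using flat[THEN is_hom_image_of_trans] by blast
  also have "\<dots> \<longleftrightarrow> (\<forall>k. card {i \<in> ?I. k + 1 \<le> fst i} \<le> Gamma_sum n k)"
    unfolding card_large_subsets[symmetric]
    by (rule hom_image_product_primitive_iff) auto
  also have "\<dots> \<longleftrightarrow> (\<forall>k\<in>{1..m}. (\<Sum>j = k+1..m+1. \<mu> j) \<le> Gamma_sum n k)"
  proof -
    have card: "card {i \<in> ?I. k + 1 \<le> fst i} = (\<Sum>j = max 2 (k+1)..m+1. \<mu> j)" for k
    proof -
      have "{i \<in> ?I. k + 1 \<le> fst i} = (SIGMA j:{max 2 (k+1)..m+1}. {..<\<mu> j})" by auto
      then show ?thesis by simp
    qed
    \<comment> \<open>The range of \<open>k\<close> may be cut down to \<open>{1..m}\<close>: all factors have at least two elements,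
      so \<open>k = 0\<close> counts the same coordinates as \<open>k = 1\<close>, and for \<open>k > m\<close> none are counted.\<close>
    have "Gamma_sum n 1 \<le> Gamma_sum n 0"
      unfolding Gamma_sum_def by (rule sum_mono2) auto
    then have "(\<Sum>j = max 2 (k+1)..m+1. \<mu> j) \<le> Gamma_sum n k"
      if bound: "\<forall>k\<in>{1..m}. (\<Sum>j = k+1..m+1. \<mu> j) \<le> Gamma_sum n k" for k
    proof -
      consider "k = 0" "m \<ge> 1" | "k > m \<or> m = 0" | "k \<in> {1..m}" by force
      then show ?thesis
      proof cases
        case 1
        have "(\<Sum>j = 2..m+1. \<mu> j) \<le> Gamma_sum n 1"
          using bspec[OF bound, of 1] 1 by (simp del: sum.cl_ivl_Suc add: numeral_2_eq_2)
        with \<open>Gamma_sum n 1 \<le> Gamma_sum n 0\<close> 1 show ?thesis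
          by (simp del: sum.cl_ivl_Suc add: numeral_2_eq_2)
      qed (use bspec[OF bound, of k] in \<open>auto simp: max_def\<close>)
    qed
    moreover have "max 2 (k + 1) = k + 1" if "k \<in> {1..m}" for k
      using that by simp
    ultimately show ?thesis
      unfolding card by metis
  qed
  finally show ?thesis .
qed

theorem proposition5p4:
  fixes h :: handedness and m :: nat and \<mu> :: "nat \<Rightarrow> nat"
  assumes "m \<ge> 1" and "\<mu> (m + 1) \<noteq> 0"
  shows "(\<forall>n. is_hom_image_of (product_of_primitives h m \<mu>) (SBA h n) \<longleftrightarrow>
            n \<ge> m \<and> (\<forall>k\<in>{1..m}. Gamma_sum n k \<ge> (\<Sum>j = k+1..m+1. \<mu> j)))
       \<and> (\<exists>n. is_hom_image_of (product_of_primitives h m \<mu>) (SBA h n))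
       \<and> (LEAST n. is_hom_image_of (product_of_primitives h m \<mu>) (SBA h n))
            = rank (product_of_primitives h m \<mu>)"
proof -
  let ?S = "product_of_primitives h m \<mu>"
  have S: "handed_skew_boolean_algebra ?S h"
    unfolding product_of_primitives_def power_alg_def
    by (intro handed_product_alg handed_primitive_alg) auto
  have "finite (carrier ?S)"
    unfolding product_of_primitives_def power_alg_def product_alg_def primitive_alg_def
    by (auto intro!: finite_PiE)
  then have ex: "\<exists>n. is_hom_image_of ?S (SBA h n)"
    by (rule finite_imp_hom_image_SBA[OF S])
  \<comment> \<open>For \<open>n < m\<close> the sum \<open>Gamma_sum n m\<close> is empty, whereas the condition for \<open>k = m\<close> bounds it
    from below by \<open>\<mu> (m + 1)\<close>, which is positive.\<close>
  have "n \<ge> m" if "\<forall>k\<in>{1..m}. Gamma_sum n k \<ge> (\<Sum>j = k+1..m+1. \<mu> j)" for n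
  proof (rule ccontr)
    assume "\<not> n \<ge> m"
    then have "Gamma_sum n m = 0" by (simp add: Gamma_sum_def)
    moreover have "Gamma_sum n m \<ge> \<mu> (m + 1)"
      using that assms(1) by force
    ultimately show False using assms(2) by simp
  qed
  then show ?thesis
    using hom_image_product_of_primitives_iff[of h m \<mu>] ex Least_hom_image_SBA_eq_rank[OF S ex]
    by blast
qed

end
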